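(* Let $\mathcal S$ be the real vector space of all tensors $S^{ijkl}=C^{(ijkl)}$, where $C$ ranges over all elasticity tensors in three dimensions. Then $\dim\mathcal S=15$.
   Context: Indices run over $1,2,3$. An elasticity tensor is a real fourth-rank tensor $C^{ijkl}$ on $\mathbb R^3$ with $C^{ijkl}=C^{jikl}$, $C^{ijkl}=C^{ijlk}$ (minor symmetries) and $C^{ijkl}=C^{klij}$ (major symmetry). $C^{(ijkl)}$ denotes total symmetrization, $\frac1{4!}$ times the sum over all permutations of the four indices. *)

theory Defs
  imports "HOL-Analysis.Analysis"
begin

text \<open>The component \<open>T\<^sup>i\<^sup>j\<^sup>k\<^sup>l\<close> of a fourth-rank tensor on \<open>\<real>\<^sup>3\<close> is \<open>T $ i $ j $ k $ l\<close>.\<close>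

type_synonym tensor4 = "real ^ 3 ^ 3 ^ 3 ^ 3"

definition elasticity_tensor :: "tensor4 \<Rightarrow> bool" where
  "elasticity_tensor C \<longleftrightarrow>
     (\<forall>i j k l. C $ i $ j $ k $ l = C $ j $ i $ k $ l) \<and>
     (\<forall>i j k l. C $ i $ j $ k $ l = C $ i $ j $ l $ k) \<and>
     (\<forall>i j k l. C $ i $ j $ k $ l = C $ k $ l $ i $ j)"

text \<open>The permutation \<open>p\<close> acts on the four index positions, numbered from 0 to 3, so equal
  index values still contribute all 24 terms.\<close>

definition total_symmetrization :: "tensor4 \<Rightarrow> tensor4" where
  "total_symmetrization T =
     (\<chi> i j k l. (1 / fact 4) * (\<Sum>p | p permutes {..<4::nat}.
        T $ ([i, j, k, l] ! p 0) $ ([i, j, k, l] ! p 1) $ ([i, j, k, l] ! p 2) $ ([i, j, k, l] ! p 3)))"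

definition symmetrized_elasticity_tensors :: "tensor4 set" where
  "symmetrized_elasticity_tensors = {total_symmetrization C | C. elasticity_tensor C}"

end

theory Submission
  imports Defs
begin

text \<open>The symmetrized elasticity tensors are exactly the totally symmetric tensors, since these
  are themselves elasticity tensors and are fixed by symmetrization. A totally symmetric
  tensor is a function of the multiset of its four indices, so the indicator tensors of the
  multisets of size 4 over a 3-element set form an orthogonal basis, and there are
  \<open>6 choose 4 = 15\<close> such multisets.\<close>

text \<open>Total symmetry is phrased through index multisets instead of permutations of positions,
  so that it matches the indicator basis directly.\<close>

definition symmetric_tensors :: "tensor4 set" where
  "symmetric_tensors = {T. \<forall>i j k l i' j' k' l'. {#i, j, k, l#} = {#i', j', k', l'#} \<longrightarrow>
     T $ i $ j $ k $ l = T $ i' $ j' $ k' $ l'}"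

definition indicator_tensor :: "3 multiset \<Rightarrow> tensor4" where
  "indicator_tensor m = (\<chi> i j k l. of_bool ({#i, j, k, l#} = m))"

lemma symmetric_tensorsD:
  "T \<in> symmetric_tensors \<Longrightarrow> {#i, j, k, l#} = {#i', j', k', l'#} \<Longrightarrow>
     T $ i $ j $ k $ l = T $ i' $ j' $ k' $ l'"
  unfolding symmetric_tensors_def by blast

lemma subspace_symmetric_tensors: "subspace symmetric_tensors"
proof (rule subspaceI)
  fix S T :: tensor4 and c :: real
  assume S: "S \<in> symmetric_tensors"
  show "c *\<^sub>R S \<in> symmetric_tensors"
    unfolding symmetric_tensors_def
  proof (intro CollectI allI impI)
    fix i j k l i' j' k' l' :: 3
    assume "{#i, j, k, l#} = {#i', j', k', l'#}"
    from symmetric_tensorsD[OF S this]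
    show "(c *\<^sub>R S) $ i $ j $ k $ l = (c *\<^sub>R S) $ i' $ j' $ k' $ l'" by simp
  qed
  assume T: "T \<in> symmetric_tensors"
  show "S + T \<in> symmetric_tensors"
    unfolding symmetric_tensors_def
  proof (intro CollectI allI impI)
    fix i j k l i' j' k' l' :: 3
    assume "{#i, j, k, l#} = {#i', j', k', l'#}"
    from symmetric_tensorsD[OF S this] symmetric_tensorsD[OF T this]
    show "(S + T) $ i $ j $ k $ l = (S + T) $ i' $ j' $ k' $ l'" by simp
  qed
qed (simp add: symmetric_tensors_def)

text \<open>Permuting the positions of a list preserves its multiset. Hence all 24 summands of the
  symmetrization agree, and their number cancels \<open>1 / fact 4\<close>.\<close>

lemma symmetric_tensor_permute:
  assumes T: "T \<in> symmetric_tensors" and p: "p permutes {..<4}"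
  shows "T $ ([i, j, k, l] ! p 0) $ ([i, j, k, l] ! p 1) $ ([i, j, k, l] ! p 2) $ ([i, j, k, l] ! p 3)
    = T $ i $ j $ k $ l"
proof (rule symmetric_tensorsD[OF T])
  let ?xs = "[i, j, k, l]"
  have "[?xs ! p 0, ?xs ! p 1, ?xs ! p 2, ?xs ! p 3] = permute_list p ?xs"
    by (simp add: permute_list_def upt_rec numeral_eq_Suc)
  moreover have "mset (permute_list p ?xs) = mset ?xs"
    using p by (intro mset_permute_list) (simp add: numeral_eq_Suc)
  ultimately have "mset [?xs ! p 0, ?xs ! p 1, ?xs ! p 2, ?xs ! p 3] = mset ?xs"
    by (simp only:)
  then show "{#?xs ! p 0, ?xs ! p 1, ?xs ! p 2, ?xs ! p 3#} = {#i, j, k, l#}"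
    by (simp only: mset.simps)
qed

lemma total_symmetrization_symmetric_tensor:
  assumes "T \<in> symmetric_tensors"
  shows "total_symmetrization T = T"
  unfolding total_symmetrization_def
  by (simp add: vec_eq_iff symmetric_tensor_permute[OF assms] card_permutations[of _ 4] del: One_nat_def)

text \<open>Two index lists with the same multiset differ by a permutation \<open>q\<close> of
  positions, and composing with \<open>q\<close> on the left only reindexes the sum over all
  permutations.\<close>

lemma total_symmetrization_in_symmetric_tensors: "total_symmetrization T \<in> symmetric_tensors"
  unfolding symmetric_tensors_def
proof (intro CollectI allI impI)
  fix i j k l i' j' k' l' :: 3
  let ?xs = "[i, j, k, l]" and ?ys = "[i', j', k', l']"
  let ?T = "\<lambda>f. T $ f 0 $ f 1 $ f 2 $ f (3::nat)"
  assume "{#i, j, k, l#} = {#i', j', k', l'#}"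
  then have "mset ?ys = mset ?xs" by simp
  then obtain q where q: "q permutes {..<length ?xs}" and ys: "permute_list q ?xs = ?ys"
    by (rule mset_eq_permutation)
  have q4: "q permutes {..<4}" using q by (simp add: numeral_eq_Suc)
  have nth: "?ys ! a = ?xs ! q a" if "a < 4" for a
    using permute_list_nth[OF q, of a] that unfolding ys by (simp add: numeral_eq_Suc)
  have "(\<Sum>p | p permutes {..<4}. ?T (\<lambda>a. ?xs ! p a)) = (\<Sum>p | p permutes {..<4}. ?T (\<lambda>a. ?xs ! (q \<circ> p) a))"
    by (rule setum_permutations_compose_left[OF q4])
  also have "\<dots> = (\<Sum>p | p permutes {..<4}. ?T (\<lambda>a. ?ys ! p a))"
  proof (rule sum.cong[OF refl])
    fix p :: "nat \<Rightarrow> nat" assume "p \<in> {p. p permutes {..<4}}"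
    \<comment> \<open>The fact \<open>nth\<close> covers positions below 4 only, so \<open>p\<close>
      has to stay among them.\<close>
    then have "p a < 4" if "a < 4" for a
      using permutes_in_image[of p "{..<4}" a] that by simp
    then show "?T (\<lambda>a. ?xs ! (q \<circ> p) a) = ?T (\<lambda>a. ?ys ! p a)"
      by (simp add: nth del: One_nat_def)
  qed
  finally show "total_symmetrization T $ i $ j $ k $ l = total_symmetrization T $ i' $ j' $ k' $ l'"
    by (simp add: total_symmetrization_def)
qed

lemma elasticity_tensor_symmetric_tensor:
  assumes "T \<in> symmetric_tensors"
  shows "elasticity_tensor T"
  unfolding elasticity_tensor_def
  by (intro conjI allI; rule symmetric_tensorsD[OF assms]; simp add: add_mset_commute)

lemma symmetrized_elasticity_tensors_eq: "symmetrized_elasticity_tensors = symmetric_tensors"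
proof
  show "symmetrized_elasticity_tensors \<subseteq> symmetric_tensors"
    unfolding symmetrized_elasticity_tensors_def
    using total_symmetrization_in_symmetric_tensors by blast
  show "symmetric_tensors \<subseteq> symmetrized_elasticity_tensors"
    unfolding symmetrized_elasticity_tensors_def
    \<comment> \<open>The preimage of a symmetric tensor is the tensor itself; unification with the
      fixed-point equation supplies it.\<close>
    by (intro subsetI CollectI exI conjI)
      (rule total_symmetrization_symmetric_tensor[symmetric] elasticity_tensor_symmetric_tensor, assumption)+
qed

lemma indicator_tensor_in_symmetric_tensors: "indicator_tensor m \<in> symmetric_tensors"
  unfolding symmetric_tensors_def indicator_tensor_def by simp

lemma finite_multisets_of_size_3: "finite (multisets_of_size (UNIV :: 3 set) n)"
  by (rule finite_multisets_of_size) simp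

text \<open>The coefficient of \<open>indicator_tensor m\<close> is the common value of
  \<open>T\<close> at all index quadruples with multiset \<open>m\<close>.\<close>

lemma symmetric_tensor_span:
  assumes "T \<in> symmetric_tensors"
  shows "T \<in> span (indicator_tensor ` multisets_of_size UNIV 4)"
proof -
  have "\<exists>c. \<forall>i j k l. {#i, j, k, l#} = m \<longrightarrow> T $ i $ j $ k $ l = c" for m
  proof (cases "\<exists>i j k l. {#i, j, k, l#} = m")
    case True
    then obtain i j k l where "{#i, j, k, l#} = m" by blast
    then have "\<forall>i' j' k' l'. {#i', j', k', l'#} = m \<longrightarrow> T $ i' $ j' $ k' $ l' = T $ i $ j $ k $ l"
      by (intro allI impI symmetric_tensorsD[OF assms]) (rule trans[OF _ sym])
    then show ?thesis by (rule exI)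
  \<comment> \<open>If no quadruple has multiset \<open>m\<close>, any \<open>c\<close> will
    do.\<close>
  qed blast
  then have "\<exists>c. \<forall>m i j k l. {#i, j, k, l#} = m \<longrightarrow> T $ i $ j $ k $ l = c m"
    by (intro choice allI)
  then obtain c where c: "\<And>i j k l. T $ i $ j $ k $ l = c {#i, j, k, l#}"
    by blast
  have "(\<Sum>m \<in> multisets_of_size UNIV 4. c m * of_bool ({#i, j, k, l#} = m)) = c {#i, j, k, l#}"
    for i j k l :: 3
  proof -
    have "{#i, j, k, l#} \<in> multisets_of_size UNIV 4"
      by (simp add: multisets_of_size_def)
    then show ?thesis
      by (simp add: of_bool_def if_distrib[of "(*) _"] finite_multisets_of_size_3 cong: if_cong)
  qed
  then have "T = (\<Sum>m \<in> multisets_of_size UNIV 4. c m *\<^sub>R indicator_tensor m)"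
    by (simp add: vec_eq_iff c indicator_tensor_def)
  also have "\<dots> \<in> span (indicator_tensor ` multisets_of_size UNIV 4)"
    by (intro span_sum span_scale span_base imageI)
  finally show ?thesis .
qed

text \<open>The supports are disjoint, so every product in the inner product vanishes.\<close>

lemma indicator_tensor_orthogonal:
  assumes "m \<noteq> n"
  shows "orthogonal (indicator_tensor m) (indicator_tensor n)"
  using assms unfolding orthogonal_def inner_vec_def indicator_tensor_def
  by (auto intro!: sum.neutral)

text \<open>A multiset of size 4 can be listed as a quadruple, and the component there is 1. For any
  other size the indicator is 0.\<close>

lemma indicator_tensor_nonzero:
  assumes "m \<in> multisets_of_size UNIV 4"
  shows "indicator_tensor m \<noteq> 0"
proof -
  obtain xs where xs: "mset xs = m" using ex_mset by blast
  then have "length xs = Suc (Suc (Suc (Suc 0)))"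
    using assms by (auto simp: multisets_of_size_def simp flip: size_mset)
  then obtain i j k l where "m = {#i, j, k, l#}"
    using xs by (auto simp: length_Suc_conv)
  then have "indicator_tensor m $ i $ j $ k $ l = 1"
    by (simp add: indicator_tensor_def)
  then show ?thesis by auto
qed

text \<open>If two distinct multisets had the same indicator, it would be orthogonal to itself and
  hence zero.\<close>

lemma inj_on_indicator_tensor: "inj_on indicator_tensor (multisets_of_size UNIV 4)"
  by (metis indicator_tensor_nonzero indicator_tensor_orthogonal inj_onI orthogonal_self)

lemma independent_indicator_tensor: "independent (indicator_tensor ` multisets_of_size UNIV 4)"
proof (rule pairwise_orthogonal_independent)
  show "pairwise orthogonal (indicator_tensor ` multisets_of_size UNIV 4)"
    unfolding pairwise_image by (auto simp: pairwise_def indicator_tensor_orthogonal)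
  show "0 \<notin> indicator_tensor ` multisets_of_size UNIV 4"
    using indicator_tensor_nonzero by force
qed

lemma dim_symmetric_tensors: "dim symmetric_tensors = 15"
proof (rule dim_unique)
  \<comment> \<open>Stars and bars with 3 index values and size 4: the upper entry is
    \<open>3 + 4 - 1 = 6\<close>.\<close>
  have "(6 choose 4) = (15 :: nat)"
    by (simp add: numeral_eq_Suc)
  then show "card (indicator_tensor ` multisets_of_size UNIV 4) = 15"
    by (simp add: card_image inj_on_indicator_tensor card_multisets_of_size)
qed (use indicator_tensor_in_symmetric_tensors symmetric_tensor_span independent_indicator_tensor in auto)

text \<open>Since \<open>dim\<close> of a set is the dimension of its span, the subspace property
  makes 15 the dimension of the set itself.\<close>

theorem proposition7:
  shows "subspace symmetrized_elasticity_tensors \<and> dim symmetrized_elasticity_tensors = 15"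
  using subspace_symmetric_tensors dim_symmetric_tensors
  by (simp add: symmetrized_elasticity_tensors_eq)

end
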